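(* There exists $p_0$ such that for every prime $p\ge p_0$ the following holds: if $A\subseteq \mathbb{F}_p$ satisfies $|A|=\alpha p$ with $\alpha\ge 0.3051$, then $A(A+A)\supseteq \mathbb{F}_p\smallsetminus\{0\}$.
   Context: For a prime $p$, $\mathbb{F}_p$ is the field with $p$ elements. For $A\subseteq\mathbb{F}_p$, $A+A=\{b+c : b,c\in A\}$ and $A(A+A)=\{a(b+c) : a,b,c\in A\}$, where $a,b,c$ need not be distinct. *)

theory Defs
  imports Complex_Main "HOL-Number_Theory.Number_Theory"
begin

text \<open>
  The field with \<open>p\<close> elements is the library's residue ring on the integers \<open>0, \<dots>, p - 1\<close> with
  arithmetic modulo \<open>p\<close>; \<open><+>\<close> and \<open><#>\<close> are the library's setwise sum and product in a ring.
\<close>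

abbreviation prime_field :: "nat \<Rightarrow> int ring" where
  "prime_field p \<equiv> residue_ring (int p)"

definition prod_of_sumset :: "('a, 'b) ring_scheme \<Rightarrow> 'a set \<Rightarrow> 'a set" where
  "prod_of_sumset F A = A <#>\<^bsub>F\<^esub> (A <+>\<^bsub>F\<^esub> A)"

lemma prod_of_sumset_eq:
  "prod_of_sumset F A =
    {a \<otimes>\<^bsub>F\<^esub> (b \<oplus>\<^bsub>F\<^esub> c) | a b c. a \<in> A \<and> b \<in> A \<and> c \<in> A}"
  unfolding prod_of_sumset_def set_add_def set_mult_def by auto

lemma field_prime_field:
  assumes "prime p"
  shows "Ring.field (prime_field p)" and "card (carrier (prime_field p)) = p"
proof -
  interpret residues_prime p "residue_ring (int p)"
    by unfold_locales (use assms in auto)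
  show "Ring.field (prime_field p)" by (rule is_field)
  show "card (carrier (prime_field p)) = p" by (simp add: residue_ring_def)
qed

end

theory Submission
  imports Defs
begin

text \<open>
  Suppose that the nonzero residue \<open>x\<close> is not of the form \<open>c (a + b)\<close> with \<open>a, b, c\<close> in \<open>A\<close>. After
  removing \<open>0\<close> and some other elements from \<open>A\<close>, which can only destroy representations, \<open>A\<close> has
  density \<open>\<alpha>\<close> close to \<open>0.305\<close>, and \<open>a + b = x / c\<close> has no solution in \<open>A\<close>. Let \<open>f\<close> and \<open>f'\<close> be the
  Fourier transforms, normalised by \<open>1 / p\<close>, of \<open>A\<close> and of the set of all \<open>x / c\<close> with \<open>c\<close> in \<open>A\<close>.
  Counting solutions by characters gives
  \<open>\<alpha>\<^sup>3 \<le> \<Sum>r\<noteq>0. \<bar>f r\<bar>\<^sup>2 * \<bar>f' r\<bar> \<le> M / 2 * (\<Sum>r\<noteq>0. \<bar>f r\<bar>\<^sup>2 + \<bar>f' r\<bar>\<^sup>2)\<close>,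
  where \<open>M\<close> is the maximum of \<open>\<bar>f r\<bar>\<close> over \<open>r \<noteq> 0\<close>.

  The idea is that additive structure of \<open>A\<close> and additive structure of its set of inverses compete
  for the same mass. The numbers \<open>f r\<close> and \<open>f' s\<close> are the coefficients of one and the same function,
  the indicator function of \<open>A\<close>, with respect to the characters \<open>e (r a)\<close> and \<open>e (s x / a)\<close>.
  Kloosterman sums are small compared to \<open>p\<close>, so the two families are almost orthogonal to each
  other, and by Bessel's inequality (lemma \<open>bessel_two_families\<close>) the energies of \<open>f\<close> and \<open>f'\<close>
  \<^emph>\<open>together\<close> are essentially at most \<open>\<alpha> (1 - \<alpha>)\<close>, the bound that Parseval gives for each alone. For
  this to be rigorous, only boundedly many frequencies may be used; the others have small
  coefficients and are negligible. Hence \<open>\<alpha>\<^sup>2 \<le> M / 2 * (1 - \<alpha>)\<close> up to a small error (lemma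
  \<open>no_solution_bound\<close>).

  A Fourier coefficient is largest for an arithmetic progression, and a simple level argument
  (lemma \<open>fourier_coefficient_le\<close>) gives \<open>M \<le> \<alpha> / 2 + sqrt 3 / (2 * pi) - 1 / 6\<close> up to an error of order
  \<open>1 / p\<close>, which is less than \<open>0.266\<close> for \<open>\<alpha> \<le> 0.3051\<close>. At \<open>\<alpha> = 0.305\<close> the two inequalities contradict
  each other.

  The required cancellation in Kloosterman sums is elementary (lemma \<open>kloosterman_bound\<close>): their
  fourth moment counts the solutions of \<open>a + b = c + d\<close>, \<open>1/a + 1/b = 1/c + 1/d\<close>, which are nearly all
  trivial, and each value occurs \<open>p - 1\<close> times in this moment.
\<close>

section \<open>Additive characters modulo a prime\<close>

locale prime_modulus =
  fixes p :: nat
  assumes prime: "prime p" and gt2: "2 < p"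
begin

definition Zp :: "int set" where "Zp = {0..<int p}"

text \<open>
  The standard additive character of the integers modulo \<open>p\<close>.
\<close>
definition e :: "int \<Rightarrow> complex" where "e k = cis (2 * pi * real_of_int k / real p)"

lemma p_pos [simp]: "0 < p" "p \<noteq> 0" using gt2 by auto

lemma prime_int: "prime (int p)" using prime by simp

lemma finite_Zp [simp]: "finite Zp" by (simp add: Zp_def)

lemma card_Zp [simp]: "card Zp = p" by (simp add: Zp_def)

lemma mod_in_Zp [simp]: "k mod int p \<in> Zp" by (simp add: Zp_def)

lemma Zp_mod: "a \<in> Zp \<Longrightarrow> a mod int p = a" by (simp add: Zp_def)

lemma zero_in_Zp [simp]: "0 \<in> Zp" by (simp add: Zp_def)

lemma Zp_eq_image: "Zp = int ` {..<p}"
  unfolding Zp_def by (metis atLeast0LessThan image_int_atLeastLessThan of_nat_0)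

lemma Zp_dvd_diff_iff: "a \<in> Zp \<Longrightarrow> b \<in> Zp \<Longrightarrow> int p dvd a - b \<longleftrightarrow> a = b"
  by (metis Zp_mod mod_eq_dvd_iff)

lemma Zp_dvd_iff: "a \<in> Zp \<Longrightarrow> int p dvd a \<longleftrightarrow> a = 0"
  using Zp_dvd_diff_iff[of a 0] by simp

lemma e_0 [simp]: "e 0 = 1" by (simp add: e_def)

lemma e_add: "e (a + b) = e a * e b"
  by (simp add: e_def cis_mult add_divide_distrib ring_distribs)

lemma cnj_e: "cnj (e a) = e (- a)"
  by (simp add: e_def cis_cnj)

lemma e_diff: "e (a - b) = e a * cnj (e b)"
  using e_add[of a "-b"] by (simp add: cnj_e)

lemma e_eq_1_iff: "e k = 1 \<longleftrightarrow> int p dvd k"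
proof
  assume "int p dvd k"
  then obtain m where "k = int p * m" by blast
  hence "e k = cis (2 * pi * real_of_int m)" by (simp add: e_def mult.assoc)
  also have "\<dots> = 1" by (rule cis_multiple_2pi) simp
  finally show "e k = 1" .
next
  assume "e k = 1"
  hence "cos (2 * pi * real_of_int k / real p) = 1"
    by (metis Re_complex_of_real cis.simps(1) e_def of_real_1)
  then obtain m :: int where "2 * pi * real_of_int k / real p = real_of_int m * 2 * pi"
    by (auto simp: cos_one_2pi_int)
  hence "real_of_int k = real_of_int (m * int p)"
    by (simp add: field_simps)
  hence "k = m * int p" by linarith
  thus "int p dvd k" by simp
qed

lemma e_cong: "int p dvd a - b \<Longrightarrow> e a = e b"
  using e_add[of "a - b" b] e_eq_1_iff[of "a - b"] by simp

lemma e_mod [simp]: "e (k mod int p) = e k"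
  by (rule e_cong) (simp add: mod_eq_dvd_iff[symmetric])

lemma e_power: "e (int j * k) = e k ^ j"
  by (induction j) (simp_all add: ring_distribs e_add)

lemma sum_e: "(\<Sum>r\<in>Zp. e (r * k)) = (if int p dvd k then of_nat p else 0)"
proof -
  have "(\<Sum>r\<in>Zp. e (r * k)) = (\<Sum>j<p. e k ^ j)"
    by (simp add: Zp_eq_image sum.reindex e_power)
  also have "\<dots> = (if int p dvd k then of_nat p else 0)"
  proof (cases "int p dvd k")
    case True
    thus ?thesis by (simp add: e_eq_1_iff[THEN iffD2])
  next
    case False
    moreover have "e k ^ p = 1" using e_power[of p k] e_eq_1_iff[of "int p * k"] by simp
    ultimately show ?thesis by (simp add: geometric_sum e_eq_1_iff)
  qed
  finally show ?thesis .
qed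

text \<open>
  Injectivity of the reduction of \<open>h\<close> modulo \<open>p\<close>. Keeping \<open>h\<close> itself integer-valued avoids carrying
  reductions through the arguments of the character.
\<close>
definition inj_mod :: "('i \<Rightarrow> int) \<Rightarrow> 'i set \<Rightarrow> bool" where
  "inj_mod h I \<longleftrightarrow> (\<forall>i\<in>I. \<forall>j\<in>I. int p dvd h i - h j \<longrightarrow> i = j)"

lemma sum_Zp_reindex:
  assumes h: "inj_mod h Zp" and f: "\<And>k. f (k mod int p) = f k"
  shows "(\<Sum>a\<in>Zp. f (h a)) = (\<Sum>a\<in>Zp. f a)"
proof -
  have "inj_on (\<lambda>a. h a mod int p) Zp"
    using h by (auto simp: inj_mod_def inj_on_def mod_eq_dvd_iff)
  moreover from this have "(\<lambda>a. h a mod int p) ` Zp = Zp"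
    by (intro endo_inj_surj) auto
  ultimately have "bij_betw (\<lambda>a. h a mod int p) Zp Zp" by (simp add: bij_betw_def)
  from sum.reindex_bij_betw[OF this, of f] show ?thesis by (simp add: f)
qed

lemma inj_mod_affine:
  assumes "\<not> int p dvd x" shows "inj_mod (\<lambda>a. x * a + y) Zp"
  unfolding inj_mod_def
proof (intro ballI impI)
  fix a b assume ab: "a \<in> Zp" "b \<in> Zp" "int p dvd x * a + y - (x * b + y)"
  hence "int p dvd x * (a - b)" by (simp add: algebra_simps)
  with assms have "int p dvd a - b" using prime_int prime_dvd_mult_iff by blast
  thus "a = b" using ab Zp_dvd_diff_iff by blast
qed

text \<open>
  The common root of the moment computations below: exchanging the sum over \<open>x\<close> with the sums over
  \<open>i\<close> and \<open>j\<close> leaves inner sums of characters, which are evaluated by orthogonality or bounded as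
  Kloosterman sums.
\<close>
lemma sum_mult_cnj_expand:
  fixes c :: "'i \<Rightarrow> complex" and d :: "'j \<Rightarrow> complex"
  shows "(\<Sum>x\<in>X. (\<Sum>i\<in>I. c i * u x i) * cnj (\<Sum>j\<in>J. d j * v x j)) =
    (\<Sum>i\<in>I. \<Sum>j\<in>J. c i * cnj (d j) * (\<Sum>x\<in>X. u x i * cnj (v x j)))"
proof -
  have "(\<Sum>x\<in>X. (\<Sum>i\<in>I. c i * u x i) * cnj (\<Sum>j\<in>J. d j * v x j)) =
    (\<Sum>x\<in>X. \<Sum>i\<in>I. \<Sum>j\<in>J. c i * cnj (d j) * (u x i * cnj (v x j)))"
    by (simp add: sum_product mult_ac)
  also have "\<dots> = (\<Sum>i\<in>I. \<Sum>x\<in>X. \<Sum>j\<in>J. c i * cnj (d j) * (u x i * cnj (v x j)))"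
    by (rule sum.swap)
  also have "\<dots> = (\<Sum>i\<in>I. \<Sum>j\<in>J. \<Sum>x\<in>X. c i * cnj (d j) * (u x i * cnj (v x j)))"
    by (intro sum.cong refl sum.swap)
  finally show ?thesis by (simp add: sum_distrib_left)
qed

text \<open>
  The index set \<open>I\<close> can be a set of frequencies, with \<open>x\<close> running over points, or a set of points,
  with \<open>x\<close> running over frequencies; both readings occur below. The function \<open>h\<close> allows for the
  frequencies \<open>x * modinv a\<close> as well.
\<close>
lemma parseval:
  assumes fin: "finite I" and h: "inj_mod h I"
  shows "(\<Sum>x\<in>Zp. (norm (\<Sum>i\<in>I. c i * e (x * h i)))\<^sup>2) = real p * (\<Sum>i\<in>I. (norm (c i))\<^sup>2)"
proof -
  have "complex_of_real (\<Sum>x\<in>Zp. (norm (\<Sum>i\<in>I. c i * e (x * h i)))\<^sup>2) =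
    (\<Sum>i\<in>I. \<Sum>j\<in>I. c i * cnj (c j) * (\<Sum>x\<in>Zp. e (x * h i) * cnj (e (x * h j))))"
    unfolding of_real_sum complex_norm_square by (rule sum_mult_cnj_expand)
  also have "\<dots> = (\<Sum>i\<in>I. \<Sum>j\<in>I. c i * cnj (c j) * (\<Sum>x\<in>Zp. e (x * (h i - h j))))"
    by (simp add: right_diff_distrib e_diff)
  also have "\<dots> = (\<Sum>i\<in>I. \<Sum>j\<in>I. if j = i then of_nat p * (c i * cnj (c i)) else 0)"
    using h by (intro sum.cong refl) (auto simp: sum_e inj_mod_def)
  also have "\<dots> = complex_of_real (real p * (\<Sum>i\<in>I. (norm (c i))\<^sup>2))"
    unfolding of_real_mult of_real_sum complex_norm_square using fin
    by (simp add: sum_distrib_left)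
  finally show ?thesis using of_real_eq_iff by blast
qed

section \<open>Modular inversion\<close>

text \<open>
  By Fermat's little theorem the power \<open>p - 2\<close> inverts the nonzero residues; it also sends \<open>0\<close> to
  \<open>0\<close>, so that inversion is a multiplicative bijection of all of \<open>Zp\<close>.
\<close>
definition modinv :: "int \<Rightarrow> int" where "modinv a = a ^ (p - 2) mod int p"

lemma modinv_in_Zp [simp]: "modinv a \<in> Zp" by (simp add: modinv_def)

lemma mult_modinv:
  assumes "\<not> int p dvd a" shows "int p dvd a * modinv a - 1"
proof -
  have "[a ^ (p - 1) = 1] (mod int p)"
  proof -
    define b where "b = nat (a mod int p)"
    have b: "int b = a mod int p" by (simp add: b_def)
    have "\<not> p dvd b" using assms b by (metis dvd_mod_iff dvd_refl int_dvd_int_iff)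
    from fermat_theorem[OF prime this] have "[int (b ^ (p - 1)) = int 1] (mod int p)"
      using cong_int_iff by blast
    thus ?thesis unfolding of_nat_power b cong_def by (simp add: power_mod)
  qed
  moreover have "a * a ^ (p - 2) = a ^ (p - 1)"
    using gt2 by (metis Suc_1 Suc_diff_Suc less_imp_le_nat power_Suc diff_Suc_1 Suc_lessD numeral_2_eq_2)
  ultimately have "[a * modinv a = 1] (mod int p)"
    unfolding modinv_def cong_def by (simp add: mod_mult_right_eq)
  thus ?thesis by (simp add: cong_iff_dvd_diff)
qed

lemma modinv_dvd: "int p dvd a \<Longrightarrow> modinv a = 0"
  unfolding modinv_def using gt2 by (metis dvd_imp_mod_0 dvd_power dvd_trans zero_less_diff)

lemma modinv_mod [simp]: "modinv (a mod int p) = modinv a"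
  by (simp add: modinv_def power_mod)

lemma modinv_mult: "int p dvd modinv (a * b) - modinv a * modinv b"
  unfolding modinv_def mod_eq_dvd_iff[symmetric]
  by (simp add: power_mult_distrib mod_mult_eq)

lemma modinv_inj: "inj_mod modinv Zp"
  unfolding inj_mod_def
proof (intro ballI impI)
  fix a b assume ab: "a \<in> Zp" "b \<in> Zp" "int p dvd modinv a - modinv b"
  hence eq: "modinv a = modinv b" using Zp_dvd_diff_iff modinv_in_Zp by blast
  have nz: "modinv c = 0 \<longleftrightarrow> c = 0" if "c \<in> Zp" for c
    using mult_modinv[of c] modinv_dvd[of c] Zp_dvd_iff[OF that] prime_int
    by (metis diff_0 dvd_minus_iff mult_zero_right not_prime_unit)
  show "a = b"
  proof (cases "b = 0")
    case True thus ?thesis using nz ab eq by metis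
  next
    case False
    hence "a \<noteq> 0" using nz ab eq by metis
    have "int p dvd b * (a * modinv a - 1) - a * (b * modinv b - 1)"
      using mult_modinv False \<open>a \<noteq> 0\<close> Zp_dvd_iff ab by (meson dvd_diff dvd_mult)
    also have "b * (a * modinv a - 1) - a * (b * modinv b - 1) = a - b"
      by (simp add: eq algebra_simps)
    finally show ?thesis using ab Zp_dvd_diff_iff by blast
  qed
qed

section \<open>An elementary bound for Kloosterman sums\<close>

text \<open>
  The summand at \<open>a = 0\<close> equals \<open>1\<close>, so this is the usual Kloosterman sum plus one. Including it
  makes every sum run over all of \<open>Zp\<close>, where orthogonality is exact.
\<close>
definition kloosterman :: "int \<Rightarrow> int \<Rightarrow> complex" where
  "kloosterman u v = (\<Sum>a\<in>Zp. e (u * a + v * modinv a))"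

lemma kloosterman_cong:
  assumes "int p dvd u - u'" "int p dvd v - v'" shows "kloosterman u v = kloosterman u' v'"
  unfolding kloosterman_def
proof (intro sum.cong refl e_cong)
  fix a
  have "u * a + v * modinv a - (u' * a + v' * modinv a) = (u - u') * a + (v - v') * modinv a"
    by (simp add: algebra_simps)
  thus "int p dvd u * a + v * modinv a - (u' * a + v' * modinv a)" using assms by simp
qed

lemma kloosterman_mod: "kloosterman (u mod int p) (v mod int p) = kloosterman u v"
  by (rule kloosterman_cong) (simp_all add: mod_eq_dvd_iff[symmetric])

text \<open>
  Substitute \<open>t * a\<close> for \<open>a\<close>. If \<open>p\<close> does not divide \<open>u\<close>, the same value is
  therefore taken at \<open>p - 1\<close> pairs \<open>(u * t, v * modinv t)\<close>, distinct modulo \<open>p\<close>, and a bound on a moment over all pairs yields a bound for each sum.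
\<close>
lemma kloosterman_twist:
  assumes "\<not> int p dvd t" shows "kloosterman (u * t) (v * modinv t) = kloosterman u v"
proof -
  have "kloosterman (u * t) (v * modinv t) = (\<Sum>a\<in>Zp. e (u * (t * a + 0) + v * modinv (t * a + 0)))"
    unfolding kloosterman_def
  proof (intro sum.cong refl e_cong)
    fix a
    have "v * (modinv (t * a) - modinv t * modinv a) =
      - (u * t * a + v * modinv t * modinv a - (u * (t * a + 0) + v * modinv (t * a + 0)))"
      by (simp add: algebra_simps)
    thus "int p dvd u * t * a + v * modinv t * modinv a - (u * (t * a + 0) + v * modinv (t * a + 0))"
      using modinv_mult by (metis dvd_minus_iff dvd_mult)
  qed
  also have "\<dots> = kloosterman u v" unfolding kloosterman_def
  proof (rule sum_Zp_reindex[OF inj_mod_affine[OF assms], of "\<lambda>k. e (u * k + v * modinv k)"])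
    fix k
    have "u * (k mod int p) - u * k = - (u * (k - k mod int p))" by (simp add: algebra_simps)
    thus "e (u * (k mod int p) + v * modinv (k mod int p)) = e (u * k + v * modinv k)"
      by (intro e_cong) simp
  qed
  finally show ?thesis .
qed

definition recip_quadruples :: "((int \<times> int) \<times> (int \<times> int)) set" where
  "recip_quadruples = {((a, b), (c, d)) | a b c d. a \<in> Zp \<and> b \<in> Zp \<and> c \<in> Zp \<and> d \<in> Zp \<and>
     int p dvd a + b - (c + d) \<and> int p dvd modinv a + modinv b - (modinv c + modinv d)}"

text \<open>
  For nonzero residues, multiplying the equation of reciprocals by \<open>abcd\<close> and inserting
  \<open>a + b = c + d\<close> gives \<open>(a + b) (c d - a b) = 0\<close>. Unless \<open>a + b = 0\<close>, the pairs \<open>a, b\<close> and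
  \<open>c, d\<close> thus have the same sum and the same product and coincide up to order: this is
  the factorisation \<open>c\<^sup>2 - c (a + b) + a b = (c - a) (c - b)\<close>.
\<close>
lemma recip_cases:
  assumes nz: "\<not> int p dvd a" "\<not> int p dvd b" "\<not> int p dvd c" "\<not> int p dvd d"
    and s: "int p dvd a + b - (c + d)"
    and i: "int p dvd modinv a + modinv b - (modinv c + modinv d)"
  shows "int p dvd a + b \<or> int p dvd c - a \<or> int p dvd c - b"
proof -
  have unit: "[x * modinv x = 1] (mod int p)" if "\<not> int p dvd x" for x
    using mult_modinv[OF that] by (simp add: cong_iff_dvd_diff)
  define w where "w = modinv a + modinv b - (modinv c + modinv d)"
  have "[(a * modinv a) * (b * c * d) + (b * modinv b) * (a * c * d)
      - ((c * modinv c) * (a * b * d) + (d * modinv d) * (a * b * c))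
      = 1 * (b * c * d) + 1 * (a * c * d) - (1 * (a * b * d) + 1 * (a * b * c))] (mod int p)"
    by (intro cong_add cong_diff cong_mult unit nz cong_refl)
  moreover have "(a * modinv a) * (b * c * d) + (b * modinv b) * (a * c * d)
      - ((c * modinv c) * (a * b * d) + (d * modinv d) * (a * b * c)) = a * b * c * d * w"
    by (simp add: w_def algebra_simps)
  moreover have "[a * b * c * d * w = 0] (mod int p)"
    using i by (simp add: w_def cong_0_iff)
  ultimately have "[(a + b) * c * d - (c + d) * a * b = 0] (mod int p)"
    by (simp add: algebra_simps cong_def)
  hence "int p dvd (a + b) * c * d - (c + d) * a * b" by (simp add: cong_0_iff)
  \<comment> \<open>Subtracting this multiple of the first equation eliminates \<open>d\<close>.\<close>
  moreover have "int p dvd (a + b - (c + d)) * (a * b - (a + b) * c)"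
    using s by simp
  ultimately have "int p dvd ((a + b) * c * d - (c + d) * a * b)
       - (a + b - (c + d)) * (a * b - (a + b) * c)" by (rule dvd_diff)
  also have "((a + b) * c * d - (c + d) * a * b) - (a + b - (c + d)) * (a * b - (a + b) * c)
      = - ((a + b) * ((c - a) * (c - b)))"
    by (simp add: algebra_simps)
  finally show ?thesis using prime_int by (simp add: prime_dvd_mult_iff)
qed

text \<open>
  Either one of the four entries is zero, or one of the three linear relations of the previous lemma
  holds. In each of these seven cases the quadruple is determined by two of its entries, because
  \<open>a + b = c + d\<close>; each case therefore contributes at most \<open>p\<^sup>2\<close> quadruples.
\<close>
lemma card_recip_quadruples: "card recip_quadruples \<le> 7 * p\<^sup>2"
proof -
  define m where "m k = k mod int p" for k
  define fs :: "((int \<times> int) \<Rightarrow> (int \<times> int) \<times> (int \<times> int)) list" where "fs =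
    [\<lambda>(a, b). ((0, a), (b, m (a - b))), \<lambda>(a, b). ((a, 0), (b, m (a - b))),
     \<lambda>(a, b). ((a, b), (0, m (a + b))), \<lambda>(a, b). ((a, b), (m (a + b), 0)),
     \<lambda>(a, b). ((a, m (- a)), (b, m (- b))),
     \<lambda>(a, b). ((a, b), (a, b)), \<lambda>(a, b). ((a, b), (b, a))]"
  have "recip_quadruples \<subseteq> (\<Union>f\<in>set fs. f ` (Zp \<times> Zp))"
  proof
    fix q assume "q \<in> recip_quadruples"
    then obtain a b c d where q: "q = ((a, b), (c, d))"
      and Z: "a \<in> Zp" "b \<in> Zp" "c \<in> Zp" "d \<in> Zp"
      and s: "int p dvd a + b - (c + d)"
      and i: "int p dvd modinv a + modinv b - (modinv c + modinv d)"
      unfolding recip_quadruples_def by blast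
    have eq: "x = m y" if "x \<in> Zp" "int p dvd x - y" for x y
      using that unfolding m_def by (metis Zp_mod mod_eq_dvd_iff)
    have d: "d = m (a + b - c)"
      by (rule eq) (use Z s in \<open>simp_all add: dvd_diff_commute algebra_simps\<close>)
    have c: "c = m (a + b - d)"
      by (rule eq) (use Z s in \<open>simp_all add: dvd_diff_commute algebra_simps\<close>)
    consider "a = 0" | "b = 0" | "c = 0" | "d = 0" |
      "int p dvd a + b" | "int p dvd c - a" | "int p dvd c - b"
      using recip_cases[OF _ _ _ _ s i] Zp_dvd_iff Z by blast
    then obtain f x y where f: "f \<in> set fs" and xy: "x \<in> Zp" "y \<in> Zp" and qf: "q = f (x, y)"
    proof cases
      case 1
      show ?thesis by (rule that[of "\<lambda>(a, b). ((0, a), (b, m (a - b)))" b c])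
        (use 1 q Z d in \<open>simp_all add: fs_def\<close>)
    next
      case 2
      show ?thesis by (rule that[of "\<lambda>(a, b). ((a, 0), (b, m (a - b)))" a c])
        (use 2 q Z d in \<open>simp_all add: fs_def\<close>)
    next
      case 3
      show ?thesis by (rule that[of "\<lambda>(a, b). ((a, b), (0, m (a + b)))" a b])
        (use 3 q Z d in \<open>simp_all add: fs_def\<close>)
    next
      case 4
      show ?thesis by (rule that[of "\<lambda>(a, b). ((a, b), (m (a + b), 0))" a b])
        (use 4 q Z c in \<open>simp_all add: fs_def\<close>)
    next
      case 5
      have "int p dvd c + d" using 5 s by (metis dvd_diff diff_diff_eq2 add_diff_cancel_left')
      hence "d = m (- c)" using Z by (intro eq) (simp_all add: add.commute)
      moreover have "b = m (- a)" using 5 Z by (intro eq) (simp_all add: add.commute)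
      ultimately show ?thesis by (intro that[of "\<lambda>(a, b). ((a, m (- a)), (b, m (- b)))" a c])
        (use q Z in \<open>simp_all add: fs_def\<close>)
    next
      case 6
      hence "c = a" using Z Zp_dvd_diff_iff by blast
      hence "d = b" using s Z Zp_dvd_diff_iff[of b d] by simp
      show ?thesis by (rule that[of "\<lambda>(a, b). ((a, b), (a, b))" a b])
        (use \<open>c = a\<close> \<open>d = b\<close> q Z in \<open>simp_all add: fs_def\<close>)
    next
      case 7
      hence "c = b" using Z Zp_dvd_diff_iff by blast
      hence "d = a" using s Z Zp_dvd_diff_iff[of a d] by simp
      show ?thesis by (rule that[of "\<lambda>(a, b). ((a, b), (b, a))" a b])
        (use \<open>c = b\<close> \<open>d = a\<close> q Z in \<open>simp_all add: fs_def\<close>)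
    qed
    thus "q \<in> (\<Union>f\<in>set fs. f ` (Zp \<times> Zp))" by blast
  qed
  hence "card recip_quadruples \<le> card (\<Union>f\<in>set fs. f ` (Zp \<times> Zp))"
    by (rule card_mono[rotated]) simp
  also have "\<dots> \<le> (\<Sum>f\<in>set fs. card (f ` (Zp \<times> Zp)))" by (rule card_UN_le) simp
  also have "\<dots> \<le> (\<Sum>f\<in>set fs. card (Zp \<times> Zp))" by (intro sum_mono card_image_le) simp
  also have "\<dots> = card (set fs) * p\<^sup>2" by (simp add: power2_eq_square)
  also have "card (set fs) \<le> 7" by (rule order_trans[OF card_length]) (simp add: fs_def)
  finally show ?thesis by simp
qed

text \<open>
  Squaring a Kloosterman sum gives a sum of characters over pairs; by orthogonality in both \<open>u\<close> and
  \<open>v\<close> its second moment is \<open>p\<^sup>2\<close> times the number of quadruples counted above.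
\<close>
lemma kloosterman_fourth_moment: "(\<Sum>(u, v)\<in>Zp \<times> Zp. norm (kloosterman u v) ^ 4) \<le> 7 * real p ^ 4"
proof -
  define Q where "Q = Zp \<times> Zp"
  define \<alpha> where "\<alpha> i = fst i + snd i" for i :: "int \<times> int"
  define \<beta> where "\<beta> i = modinv (fst i) + modinv (snd i)" for i :: "int \<times> int"
  have finQ: "finite Q" by (simp add: Q_def)
  have sq: "(kloosterman (fst w) (snd w))\<^sup>2 = (\<Sum>i\<in>Q. 1 * e (fst w * \<alpha> i + snd w * \<beta> i))" for w
  proof -
    have "(kloosterman (fst w) (snd w))\<^sup>2 = (\<Sum>(a, b)\<in>Q. e (fst w * a + snd w * modinv a) * e (fst w * b + snd w * modinv b))"
      unfolding Q_def power2_eq_square kloosterman_def sum_product sum.cartesian_product by simp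
    also have "\<dots> = (\<Sum>i\<in>Q. 1 * e (fst w * \<alpha> i + snd w * \<beta> i))"
      unfolding case_prod_beta by (intro sum.cong refl) (simp add: \<alpha>_def \<beta>_def e_add[symmetric] algebra_simps)
    finally show ?thesis .
  qed
  have "complex_of_real (\<Sum>w\<in>Q. norm (kloosterman (fst w) (snd w)) ^ 4) =
      (\<Sum>w\<in>Q. complex_of_real ((norm ((kloosterman (fst w) (snd w))\<^sup>2))\<^sup>2))"
    by (simp add: norm_power power_mult[symmetric])
  also have "\<dots> = (\<Sum>i\<in>Q. \<Sum>j\<in>Q. 1 * cnj 1 *
      (\<Sum>w\<in>Q. e (fst w * \<alpha> i + snd w * \<beta> i) * cnj (e (fst w * \<alpha> j + snd w * \<beta> j))))"
    unfolding sq complex_norm_square by (rule sum_mult_cnj_expand)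
  also have "\<dots> = (\<Sum>i\<in>Q. \<Sum>j\<in>Q. (\<Sum>u\<in>Zp. e (u * (\<alpha> i - \<alpha> j))) * (\<Sum>v\<in>Zp. e (v * (\<beta> i - \<beta> j))))"
  proof (intro sum.cong refl)
    fix i j
    have "(\<Sum>w\<in>Q. e (fst w * \<alpha> i + snd w * \<beta> i) * cnj (e (fst w * \<alpha> j + snd w * \<beta> j))) =
        (\<Sum>w\<in>Q. e (fst w * (\<alpha> i - \<alpha> j)) * e (snd w * (\<beta> i - \<beta> j)))"
      by (simp add: e_diff[symmetric] e_add[symmetric] algebra_simps)
    also have "\<dots> = (\<Sum>u\<in>Zp. e (u * (\<alpha> i - \<alpha> j))) * (\<Sum>v\<in>Zp. e (v * (\<beta> i - \<beta> j)))"
      unfolding sum_product sum.cartesian_product Q_def by (simp add: case_prod_beta)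
    finally show "1 * cnj 1 * (\<Sum>w\<in>Q. e (fst w * \<alpha> i + snd w * \<beta> i) * cnj (e (fst w * \<alpha> j + snd w * \<beta> j))) =
        (\<Sum>u\<in>Zp. e (u * (\<alpha> i - \<alpha> j))) * (\<Sum>v\<in>Zp. e (v * (\<beta> i - \<beta> j)))" by simp
  qed
  also have "\<dots> = (\<Sum>z\<in>Q\<times>Q. if z \<in> recip_quadruples then of_nat (p\<^sup>2) else 0)"
    unfolding sum.cartesian_product
    by (intro sum.cong refl) (auto simp: sum_e recip_quadruples_def Q_def \<alpha>_def \<beta>_def power2_eq_square)
  also have "\<dots> = of_nat (p\<^sup>2 * card recip_quadruples)"
  proof -
    have "recip_quadruples \<subseteq> Q \<times> Q" by (auto simp: recip_quadruples_def Q_def)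
    hence "Q \<times> Q \<inter> recip_quadruples = recip_quadruples" by blast
    thus ?thesis using finQ by (simp add: sum.If_cases mult.commute)
  qed
  finally have "(\<Sum>w\<in>Q. norm (kloosterman (fst w) (snd w)) ^ 4) = real (p\<^sup>2 * card recip_quadruples)"
    by (metis of_real_eq_iff of_real_of_nat_eq)
  also have "\<dots> \<le> real (p\<^sup>2 * (7 * p\<^sup>2))"
    using card_recip_quadruples by (intro of_nat_mono mult_le_mono2)
  also have "\<dots> = 7 * real p ^ 4" by (simp add: power2_eq_square power4_eq_xxxx)
  finally show ?thesis by (simp add: Q_def case_prod_beta)
qed

text \<open>
  This is Kloosterman's bound of order \<open>p\<close> to the power \<open>3/4\<close>. The application
  only uses that Kloosterman sums are \<open>o(p)\<close>.
\<close>
lemma kloosterman_bound: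
  assumes "\<not> int p dvd u" shows "norm (kloosterman u v) ^ 4 \<le> 14 * real p ^ 3"
proof -
  define T where "T = Zp - {0}"
  define h where "h t = ((u * t) mod int p, (v * modinv t) mod int p)" for t
  have cardT: "card T = p - 1" by (simp add: T_def)
  have "inj_on h T"
  proof (rule inj_onI)
    fix s t assume "s \<in> T" "t \<in> T" "h s = h t"
    hence "int p dvd (u * s + 0) - (u * t + 0)" by (simp add: h_def mod_eq_dvd_iff)
    with inj_mod_affine[OF assms, of 0] \<open>s \<in> T\<close> \<open>t \<in> T\<close> show "s = t"
      unfolding inj_mod_def T_def by blast
  qed
  have "real (p - 1) * norm (kloosterman u v) ^ 4 = (\<Sum>t\<in>T. norm (kloosterman u v) ^ 4)" by (simp add: cardT)
  also have "\<dots> = (\<Sum>t\<in>T. norm (kloosterman (fst (h t)) (snd (h t))) ^ 4)"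
  proof (intro sum.cong refl)
    fix t assume "t \<in> T"
    hence "\<not> int p dvd t" using Zp_dvd_iff by (auto simp: T_def)
    thus "norm (kloosterman u v) ^ 4 = norm (kloosterman (fst (h t)) (snd (h t))) ^ 4"
      by (simp add: h_def kloosterman_mod kloosterman_twist)
  qed
  also have "\<dots> = (\<Sum>w\<in>h ` T. norm (kloosterman (fst w) (snd w)) ^ 4)"
    using \<open>inj_on h T\<close> by (simp add: sum.reindex)
  also have "\<dots> \<le> (\<Sum>w\<in>Zp \<times> Zp. norm (kloosterman (fst w) (snd w)) ^ 4)"
    by (intro sum_mono2) (auto simp: h_def)
  also have "\<dots> \<le> 7 * real p ^ 4" using kloosterman_fourth_moment by (simp add: case_prod_beta)
  finally have 1: "real (p - 1) * norm (kloosterman u v) ^ 4 \<le> 7 * real p ^ 4" .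
  have "real p / 2 * norm (kloosterman u v) ^ 4 \<le> real (p - 1) * norm (kloosterman u v) ^ 4"
    using gt2 by (intro mult_right_mono) (auto simp: of_nat_diff)
  with 1 have "real p * norm (kloosterman u v) ^ 4 \<le> 14 * real p ^ 4" by linarith
  also have "14 * real p ^ 4 = real p * (14 * real p ^ 3)" by (simp add: eval_nat_numeral)
  finally have "real p * norm (kloosterman u v) ^ 4 \<le> real p * (14 * real p ^ 3)" .
  thus ?thesis by (rule mult_left_le_imp_le) simp
qed

section \<open>A Bessel inequality for two families of characters\<close>

text \<open>
  The characters \<open>e (r * a)\<close> and \<open>e (s * g a)\<close>, as functions of \<open>a\<close>, are orthogonal within each of the
  two families. If they are also nearly orthogonal across the families, with inner products at most
  \<open>K\<close>, then the energies of the indicator function of \<open>A\<close> in both families together cannot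
  exceed its squared norm by more than a small error. For the proof, expand the nonnegative squared distance between \<open>p\<close> times this indicator
  function and the approximation \<open>W\<close> formed with its own coefficients. The frequency \<open>0\<close> is added
  to the first family; it accounts for the term \<open>(card A)\<^sup>2\<close>.
\<close>
lemma bessel_two_families:
  fixes g :: "int \<Rightarrow> int" and A R :: "int set" and K :: real
  defines "f \<equiv> \<lambda>r. \<Sum>a\<in>A. e (r * a)" and "f' \<equiv> \<lambda>r. \<Sum>a\<in>A. e (r * g a)"
  assumes A: "A \<subseteq> Zp" and g: "inj_mod g Zp" and R: "R \<subseteq> Zp - {0}"
    and K: "\<And>r s. r \<in> R \<Longrightarrow> s \<in> R \<Longrightarrow> norm (\<Sum>a\<in>Zp. e (r * a - s * g a)) \<le> K"
  shows "(\<Sum>r\<in>R. (norm (f r))\<^sup>2 + (norm (f' r))\<^sup>2) \<le>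
    real p * real (card A) - (real (card A))\<^sup>2
      + 2 * K / real p * ((\<Sum>r\<in>R. norm (f r)) * (\<Sum>r\<in>R. norm (f' r)))"
proof -
  define n where "n = real (card A)"
  define R0 where "R0 = insert 0 R"
  have fin: "finite R" "finite A" using R A by (auto intro: finite_subset[OF _ finite_Zp])
  have R0: "finite R0" "R0 \<subseteq> Zp" "0 \<notin> R" "R \<subseteq> Zp" using fin R by (auto simp: R0_def)
  have f0: "f 0 = of_real n" by (simp add: f_def n_def)
  have inj: "inj_mod (\<lambda>r. r) X" if "X \<subseteq> Zp" for X
    using that Zp_dvd_diff_iff by (auto simp: inj_mod_def)
  define U where "U a = (\<Sum>r\<in>R0. cnj (f r) * e (a * r))" for a
  define V where "V a = (\<Sum>s\<in>R. cnj (f' s) * e (g a * s))" for a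
  define S where "S = (\<Sum>r\<in>R. (norm (f r))\<^sup>2 + (norm (f' r))\<^sup>2)"
  define X where "X = (\<Sum>r\<in>R. norm (f r)) * (\<Sum>r\<in>R. norm (f' r))"
  have sumR0: "(\<Sum>r\<in>R0. (norm (f r))\<^sup>2) = n\<^sup>2 + (\<Sum>r\<in>R. (norm (f r))\<^sup>2)"
    using fin R0 by (simp add: R0_def f0)
  have U: "(\<Sum>a\<in>Zp. (norm (U a))\<^sup>2) = real p * (n\<^sup>2 + (\<Sum>r\<in>R. (norm (f r))\<^sup>2))"
    using parseval[OF R0(1) inj[OF R0(2)], of "\<lambda>r. cnj (f r)"] by (simp add: U_def sumR0)
  have V: "(\<Sum>a\<in>Zp. (norm (V a))\<^sup>2) = real p * (\<Sum>r\<in>R. (norm (f' r))\<^sup>2)"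
  proof -
    have "(\<Sum>a\<in>Zp. (norm (V a))\<^sup>2) = (\<Sum>a\<in>Zp. (norm (\<Sum>s\<in>R. cnj (f' s) * e (a * s)))\<^sup>2)"
      unfolding V_def
    proof (rule sum_Zp_reindex[OF g, of "\<lambda>k. (norm (\<Sum>s\<in>R. cnj (f' s) * e (k * s)))\<^sup>2"])
      fix k
      have "e ((k mod int p) * s) = e (k * s)" for s
        using e_mod[of "(k mod int p) * s"] e_mod[of "k * s"] by (simp add: mod_mult_left_eq)
      thus "(norm (\<Sum>s\<in>R. cnj (f' s) * e ((k mod int p) * s)))\<^sup>2 = (norm (\<Sum>s\<in>R. cnj (f' s) * e (k * s)))\<^sup>2"
        by simp
    qed
    thus ?thesis using parseval[OF fin(1) inj[OF R0(4)], of "\<lambda>s. cnj (f' s)"] by simp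
  qed
  have cross: "norm (\<Sum>a\<in>Zp. U a * cnj (V a)) \<le> K * X"
  proof -
    define C where "C r s = (\<Sum>a\<in>Zp. e (a * r) * cnj (e (g a * s)))" for r s
    have C: "C r s = (\<Sum>a\<in>Zp. e (r * a - s * g a))" for r s
      by (simp add: C_def e_diff mult.commute)
    have C0: "C 0 s = 0" if "s \<in> R" for s
    proof -
      have "C 0 s = (\<Sum>a\<in>Zp. e (- (s * g a)))" by (simp add: C)
      also have "\<dots> = (\<Sum>a\<in>Zp. e (- (s * a)))"
      proof (rule sum_Zp_reindex[OF g, of "\<lambda>k. e (- (s * k))"])
        fix k
        have "- (s * (k mod int p)) - - (s * k) = s * (k - k mod int p)" by (simp add: algebra_simps)
        thus "e (- (s * (k mod int p))) = e (- (s * k))" by (intro e_cong) simp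
      qed
      also have "\<dots> = (\<Sum>a\<in>Zp. e (a * (- s)))" by (simp add: mult.commute)
      also have "\<dots> = 0" using that R Zp_dvd_iff[of s] unfolding sum_e by auto
      finally show ?thesis .
    qed
    have "(\<Sum>a\<in>Zp. U a * cnj (V a)) = (\<Sum>r\<in>R0. \<Sum>s\<in>R. cnj (f r) * cnj (cnj (f' s)) * C r s)"
      unfolding U_def V_def C_def by (rule sum_mult_cnj_expand)
    also have "\<dots> = (\<Sum>r\<in>R. \<Sum>s\<in>R. cnj (f r) * f' s * C r s)"
      using R0 fin by (simp add: R0_def C0)
    also have "norm \<dots> \<le> (\<Sum>r\<in>R. \<Sum>s\<in>R. norm (f r) * norm (f' s) * K)"
      by (intro sum_norm_le) (auto simp: norm_mult C intro!: mult_left_mono K)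
    also have "\<dots> = K * X"
    proof -
      have "X = (\<Sum>r\<in>R. \<Sum>s\<in>R. norm (f r) * norm (f' s))"
        unfolding X_def by (rule sum_product)
      thus ?thesis
        unfolding sum_distrib_left by (simp only: sum_distrib_left mult.commute[of K])
    qed
    finally show ?thesis .
  qed
  have main: "(\<Sum>a\<in>A. U a + V a) = of_real (n\<^sup>2 + S)"
  proof -
    have fs: "f r = (\<Sum>a\<in>A. e (a * r))" and f's: "f' r = (\<Sum>a\<in>A. e (g a * r))" for r
      by (simp_all add: f_def f'_def mult.commute)
    have "(\<Sum>a\<in>A. U a) = (\<Sum>r\<in>R0. cnj (f r) * f r)"
      unfolding U_def by (subst sum.swap) (simp only: fs sum_distrib_left[symmetric])
    moreover have "(\<Sum>a\<in>A. V a) = (\<Sum>r\<in>R. cnj (f' r) * f' r)"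
      unfolding V_def by (subst sum.swap) (simp only: f's sum_distrib_left[symmetric])
    ultimately have "(\<Sum>a\<in>A. U a + V a) = of_real ((\<Sum>r\<in>R0. (norm (f r))\<^sup>2) + (\<Sum>r\<in>R. (norm (f' r))\<^sup>2))"
      unfolding of_real_add of_real_sum complex_norm_square by (simp add: sum.distrib mult.commute)
    thus ?thesis unfolding sumR0 by (simp add: S_def sum.distrib)
  qed
  define W where "W a = U a + V a" for a
  define b where "b a = (if a \<in> A then real p else 0)" for a
  have b2: "(\<Sum>a\<in>Zp. (b a)\<^sup>2) = (real p)\<^sup>2 * n"
    using A by (simp add: b_def n_def if_distrib[of "\<lambda>x. x\<^sup>2"] sum.If_cases Int_absorb1 cong: if_cong)
  have bW: "(\<Sum>a\<in>Zp. b a * Re (W a)) = real p * (n\<^sup>2 + S)"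
  proof -
    have "(\<Sum>a\<in>Zp. b a * Re (W a)) = (\<Sum>a\<in>A. real p * Re (W a))"
      using A by (intro sum.mono_neutral_cong_right) (auto simp: b_def)
    also have "\<dots> = real p * Re (\<Sum>a\<in>A. W a)" by (simp add: sum_distrib_left)
    finally show ?thesis using main by (simp add: W_def)
  qed
  have W2: "(\<Sum>a\<in>Zp. (norm (W a))\<^sup>2) \<le> real p * (n\<^sup>2 + S) + 2 * (K * X)"
  proof -
    have "(norm (x + y))\<^sup>2 = (norm x)\<^sup>2 + (norm y)\<^sup>2 + 2 * Re (x * cnj y)" for x y
      unfolding cmod_power2 by (simp add: power2_eq_square algebra_simps)
    hence "(\<Sum>a\<in>Zp. (norm (W a))\<^sup>2) =
        (\<Sum>a\<in>Zp. (norm (U a))\<^sup>2 + (norm (V a))\<^sup>2 + 2 * Re (U a * cnj (V a)))"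
      unfolding W_def by (intro sum.cong refl)
    hence "(\<Sum>a\<in>Zp. (norm (W a))\<^sup>2) = real p * (n\<^sup>2 + S) + 2 * Re (\<Sum>a\<in>Zp. U a * cnj (V a))"
      unfolding sum.distrib sum_distrib_left[symmetric] U V Re_sum S_def
      by (simp only: distrib_left add.assoc)
    moreover have "Re (\<Sum>a\<in>Zp. U a * cnj (V a)) \<le> K * X"
      using cross complex_Re_le_cmod order_trans by blast
    ultimately show ?thesis by linarith
  qed
  have "0 \<le> (\<Sum>a\<in>Zp. (norm (W a - of_real (b a)))\<^sup>2)" by (simp add: sum_nonneg)
  also have "\<dots> = (\<Sum>a\<in>Zp. (norm (W a))\<^sup>2) - 2 * (\<Sum>a\<in>Zp. b a * Re (W a)) + (\<Sum>a\<in>Zp. (b a)\<^sup>2)"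
    unfolding sum_distrib_left sum_subtractf[symmetric] sum.distrib[symmetric]
    unfolding cmod_power2 by (intro sum.cong refl) (simp add: power2_eq_square algebra_simps)
  finally have "real p * (n\<^sup>2 + S) \<le> (real p)\<^sup>2 * n + 2 * (K * X)"
    using b2 bW W2 by linarith
  hence "real p * (n\<^sup>2 + S) \<le> real p * (real p * n + 2 * K / real p * X)"
    by (simp add: algebra_simps power2_eq_square)
  hence "n\<^sup>2 + S \<le> real p * n + 2 * K / real p * X"
    by (rule mult_left_le_imp_le) simp
  thus ?thesis by (simp add: S_def n_def X_def)
qed

end

section \<open>The largest possible Fourier coefficient\<close>

lemma pi_gt_31_10: "31 / 10 < pi"
proof (rule ccontr)
  assume "\<not> 31 / 10 < pi"
  hence "sin (pi / 6) \<le> sin (31 / 60 :: real)"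
    using pi_ge_two by (intro sin_monotone_2pi_le) auto
  \<comment> \<open>The Taylor polynomial of degree 4 shows that \<open>sin (31 / 60)\<close> is below \<open>sin (pi / 6) = 1 / 2\<close>.\<close>
  moreover have "\<bar>sin (31 / 60 :: real) - (\<Sum>m<5. sin_coeff m * (31 / 60) ^ m)\<bar>
      \<le> inverse (fact 5) * \<bar>31 / 60\<bar> ^ 5"
    by (rule Maclaurin_sin_bound)
  hence "\<bar>sin (31 / 60 :: real) - 639809 / 1296000\<bar> \<le> 28629151 / 93312000000"
    by (simp add: sin_coeff_def lessThan_nat_numeral fact_numeral power_divide)
  hence "sin (31 / 60 :: real) < 1 / 2" by arith
  ultimately show False by (simp add: sin_30)
qed

lemma abs_cos_diff_le: "\<bar>cos x - cos y\<bar> \<le> \<bar>x - y\<bar>" for x y :: real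
proof -
  have "\<bar>cos x - cos y\<bar> = 2 * \<bar>sin ((x + y) / 2)\<bar> * \<bar>sin ((y - x) / 2)\<bar>"
    by (simp add: cos_diff_cos abs_mult)
  also have "\<dots> \<le> 2 * 1 * \<bar>(y - x) / 2\<bar>"
    by (intro mult_mono abs_sin_x_le_abs_x) auto
  finally show ?thesis by simp
qed

lemma cos_le_half:
  fixes x :: real
  assumes "pi / 3 \<le> x" "x \<le> 2 * pi - pi / 3" shows "cos x \<le> 1 / 2"
proof -
  have *: "cos y \<le> 1 / 2" if "pi / 3 \<le> y" "y \<le> pi" for y
    using cos_monotone_0_pi_le[of "pi / 3" y] that by (simp add: cos_60)
  show ?thesis
  proof (cases "x \<le> pi")
    case False
    hence "cos (2 * pi - x) \<le> 1 / 2" using assms by (intro *) auto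
    thus ?thesis by (simp add: cos_diff)
  qed (use * assms in auto)
qed

text \<open>
  Since the cosine decreases on \<open>[0, pi]\<close>, the left-hand side is a lower Riemann sum for its integral.
\<close>
lemma sum_cos_le_sin:
  fixes h :: real
  assumes "0 < h" "h * real j \<le> pi"
  shows "h * (\<Sum>k = 1..j. cos (h * real k)) \<le> sin (h * real j)"
  using assms(2)
proof (induction j)
  case (Suc j)
  let ?x = "h * real j" and ?y = "h * real (Suc j)"
  have "?x < ?y" using assms(1) by simp
  then obtain z where z: "?x < z" "z < ?y" "sin ?y - sin ?x = (?y - ?x) * cos z"
    using MVT2[of ?x ?y sin cos] by (auto intro: DERIV_sin)
  have "cos ?y \<le> cos z" using z Suc.prems assms(1)
    by (intro cos_monotone_0_pi_le) (auto intro: order_trans[OF _ less_imp_le[OF z(1)]])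
  hence "h * cos ?y \<le> h * cos z" using assms(1) by simp
  also have "\<dots> = sin ?y - sin ?x" using z(3) by (simp add: algebra_simps)
  moreover have "?x \<le> pi" using \<open>?x < ?y\<close> Suc.prems by linarith
  hence "h * (\<Sum>k = 1..j. cos (h * real k)) \<le> sin ?x" by (rule Suc.IH)
  ultimately show ?case by (simp add: distrib_left)
qed simp

text \<open>
  Divided by \<open>p\<close>, the left-hand side is a Riemann sum for the mean over the circle of the positive
  part of \<open>cos - 1/2\<close>, which is \<open>sqrt 3 / (2 * pi) - 1 / 6\<close>: the integrand is positive on an arc of
  relative length \<open>1/3\<close> around \<open>0\<close>.
\<close>
lemma sum_cos_excess_le:
  fixes p :: nat
  assumes "0 < p"
  shows "(\<Sum>k<p. max 0 (cos (2 * pi * real k / real p) - 1 / 2))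
    \<le> real p * (sqrt 3 / (2 * pi) - 1 / 6) + 3 / 2"
proof -
  define h where "h = 2 * pi / real p"
  define F where "F k = max 0 (cos (h * real k) - 1 / 2)" for k
  define J where "J = p div 6"
  have h: "0 < h" "h * real p = 2 * pi" using assms by (simp_all add: h_def)
  have J: "6 * J \<le> p" "p \<le> 6 * J + 5" by (simp_all add: J_def)
  have hJ: "h * real J \<le> pi / 3"
  proof -
    have "h * real (6 * J) \<le> h * real p" using J h by (intro mult_left_mono) auto
    thus ?thesis using h(2) by simp
  qed
  have large: "pi / 3 \<le> h * real k" if "J < k" for k
  proof -
    have "h * real p \<le> h * real (6 * k)" using J that h by (intro mult_left_mono) auto
    thus ?thesis using h(2) by simp
  qed
  have refl: "F (p - k) = F k" if "k \<le> p" for k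
    using that h(2) by (simp add: F_def of_nat_diff right_diff_distrib cos_diff)
  have zero: "F k = 0" if "J < k" "k < p - J" for k
  proof -
    have "pi / 3 \<le> h * real (p - k)" using that by (intro large) simp
    hence "h * real k \<le> 2 * pi - pi / 3"
      using that h(2) by (simp add: of_nat_diff right_diff_distrib)
    with large[OF that(1)] have "cos (h * real k) \<le> 1 / 2" by (intro cos_le_half)
    thus ?thesis by (simp add: F_def)
  qed
  have part: "(\<Sum>k=1..J. F k) \<le> real p * (sqrt 3 / (4 * pi)) - real p / 12 + 5 / 12"
  proof -
    have "F k = cos (h * real k) - 1 / 2" if "k \<in> {1..J}" for k
    proof -
      have "h * real k \<le> h * real J" using that h by (intro mult_left_mono) auto
      hence "h * real k \<le> pi / 3" using hJ by linarith
      hence "cos (pi / 3) \<le> cos (h * real k)" using h by (intro cos_monotone_0_pi_le) auto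
      thus ?thesis by (simp add: F_def cos_60)
    qed
    hence "(\<Sum>k=1..J. F k) = (\<Sum>k=1..J. cos (h * real k)) - real J / 2"
      by (simp add: sum_subtractf)
    moreover have "h * (\<Sum>k=1..J. cos (h * real k)) \<le> sqrt 3 / 2"
    proof -
      have "h * (\<Sum>k=1..J. cos (h * real k)) \<le> sin (h * real J)"
        using h hJ pi_gt_zero by (intro sum_cos_le_sin) linarith+
      also have "\<dots> \<le> sin (pi / 3)"
        using h hJ by (intro sin_monotone_2pi_le) (auto intro: order_trans[of _ 0])
      finally show ?thesis by (simp add: sin_60)
    qed
    hence "(\<Sum>k=1..J. cos (h * real k)) \<le> sqrt 3 / 2 / h"
      using h by (simp add: field_simps)
    hence "(\<Sum>k=1..J. cos (h * real k)) \<le> real p * (sqrt 3 / (4 * pi))"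
      using assms by (simp add: h_def field_simps)
    moreover have "real p / 12 - 5 / 12 \<le> real J / 2" using J(2) by simp
    ultimately show ?thesis by linarith
  qed
  have "(\<Sum>k<p. F k) = (\<Sum>k\<in>{0} \<union> {1..J} \<union> {p - J..<p}. F k)"
    using J assms by (intro sum.mono_neutral_right) (auto intro!: zero)
  also have "\<dots> \<le> F 0 + (\<Sum>k=1..J. F k) + (\<Sum>k\<in>{p - J..<p}. F k)"
  proof -
    have nonneg: "0 \<le> F k" for k by (simp add: F_def)
    have "{1..J} \<inter> {p - J..<p} = {}" "0 \<notin> {1..J} \<union> {p - J..<p}" using J assms by auto
    thus ?thesis by (simp add: sum.union_disjoint)
  qed
  also have "(\<Sum>k\<in>{p - J..<p}. F k) = (\<Sum>k=1..J. F k)"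
    by (rule sum.reindex_bij_witness[of _ "\<lambda>k. p - k" "\<lambda>k. p - k"]) (use J refl in auto)
  also have "F 0 = 1 / 2" by (simp add: F_def)
  finally have "(\<Sum>k<p. F k) \<le> 1 / 2 + 2 * (\<Sum>k=1..J. F k)" by simp
  also have "\<dots> \<le> 1 / 2 + 2 * (real p * (sqrt 3 / (4 * pi)) - real p / 12 + 5 / 12)"
    using part by simp
  also have "\<dots> \<le> real p * (sqrt 3 / (2 * pi) - 1 / 6) + 3 / 2"
    by (simp add: algebra_simps)
  finally show ?thesis by (simp add: F_def h_def)
qed

context prime_modulus begin

text \<open>
  After a rotation the coefficient is a sum of cosines over \<open>A\<close>. Moving the angle of rotation to
  the nearest multiple of \<open>2 * pi / p\<close> changes each summand by at most \<open>pi / p\<close>, so the sum by at most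
  \<open>pi\<close>, and turns the sum into one over a translate of a dilate of \<open>A\<close>. Then each cosine is at most
  \<open>1/2\<close> plus the positive part of its excess over \<open>1/2\<close>, and the excesses are summed over all
  residues. The level \<open>1/2\<close> is the optimal choice for sets of density \<open>1/3\<close> and costs little at the
  density of about \<open>0.305\<close> for which the lemma is used.
\<close>
lemma fourier_coefficient_le:
  assumes A: "A \<subseteq> Zp" and r: "\<not> int p dvd r"
  shows "norm (\<Sum>a\<in>A. e (r * a)) \<le> real (card A) / 2 + real p * (sqrt 3 / (2 * pi) - 1 / 6) + 6"
proof -
  define z where "z = (\<Sum>a\<in>A. e (r * a))"
  define \<theta> where "\<theta> = Arg z"
  define m where "m = round (\<theta> * real p / (2 * pi))"
  define c where "c k = cos (2 * pi * real_of_int k / real p)" for k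
  have c: "c k = Re (e k)" for k by (simp add: c_def e_def)
  have fin: "finite A" using A finite_Zp finite_subset by blast
  have card: "card A \<le> p" using A card_mono[of Zp A] by simp
  have "z * cis (- \<theta>) = of_real (norm z)"
    by (metis \<theta>_def rcis_cmod_Arg rcis_def mult.assoc cis_mult add.right_inverse cis_zero mult.right_neutral)
  hence "norm z = Re (z * cis (- \<theta>))" by simp
  also have "\<dots> = (\<Sum>a\<in>A. cos (2 * pi * real_of_int (r * a) / real p - \<theta>))"
    unfolding z_def e_def sum_distrib_right cis_mult by simp
  also have "\<dots> \<le> (\<Sum>a\<in>A. c (r * a + - m) + pi / real p)"
  proof (intro sum_mono)
    fix a
    have "\<bar>real_of_int m - \<theta> * real p / (2 * pi)\<bar> \<le> 1 / 2"
      unfolding m_def by (rule of_int_round_abs_le)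
    hence "2 * pi / real p * \<bar>real_of_int m - \<theta> * real p / (2 * pi)\<bar> \<le> 2 * pi / real p * (1 / 2)"
      by (intro mult_left_mono) auto
    hence "\<bar>2 * pi / real p * (real_of_int m - \<theta> * real p / (2 * pi))\<bar> \<le> pi / real p"
      unfolding abs_mult by simp
    moreover have "2 * pi / real p * (real_of_int m - \<theta> * real p / (2 * pi)) =
      (2 * pi * real_of_int (r * a) / real p - \<theta>) - 2 * pi * real_of_int (r * a + - m) / real p"
      by (simp add: field_simps)
    ultimately have "\<bar>(2 * pi * real_of_int (r * a) / real p - \<theta>)
        - 2 * pi * real_of_int (r * a + - m) / real p\<bar> \<le> pi / real p" by (simp only:)
    from order_trans[OF abs_cos_diff_le this]
    show "cos (2 * pi * real_of_int (r * a) / real p - \<theta>) \<le> c (r * a + - m) + pi / real p"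
      unfolding c_def by linarith
  qed
  also have "\<dots> \<le> (\<Sum>a\<in>A. (max 0 (c (r * a + - m) - 1 / 2) + 1 / 2) + pi / real p)"
    by (intro sum_mono) auto
  also have "\<dots> = (\<Sum>a\<in>A. max 0 (c (r * a + - m) - 1 / 2)) + real (card A) / 2
      + real (card A) / real p * pi"
    by (simp add: sum.distrib)
  also have "(\<Sum>a\<in>A. max 0 (c (r * a + - m) - 1 / 2)) \<le> (\<Sum>a\<in>Zp. max 0 (c (r * a + - m) - 1 / 2))"
    using A by (intro sum_mono2) auto
  also have "\<dots> = (\<Sum>a\<in>Zp. max 0 (c a - 1 / 2))"
    by (rule sum_Zp_reindex[OF inj_mod_affine[OF r], of "\<lambda>k. max 0 (c k - 1 / 2)"]) (simp add: c)
  also have "\<dots> = (\<Sum>k<p. max 0 (cos (2 * pi * real k / real p) - 1 / 2))"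
    by (simp add: Zp_eq_image sum.reindex c_def)
  also have "\<dots> \<le> real p * (sqrt 3 / (2 * pi) - 1 / 6) + 3 / 2"
    by (rule sum_cos_excess_le) simp
  finally have "norm z \<le> real p * (sqrt 3 / (2 * pi) - 1 / 6) + 3 / 2 + real (card A) / 2
      + real (card A) / real p * pi" by simp
  moreover have "real (card A) / real p * pi \<le> 1 * pi"
    using card by (intro mult_right_mono) auto
  ultimately show ?thesis using pi_less_4 unfolding z_def by linarith
qed

section \<open>Solving a + b = x / c in a set\<close>

text \<open>
  Write \<open>f\<close> and \<open>f'\<close> for the Fourier transforms of \<open>A\<close> and of the set of the residues \<open>x / c\<close> with
  \<open>c\<close> in \<open>A\<close>. In the absence of solutions the mean of \<open>f\<^sup>2 * cnj f'\<close> vanishes, so the frequency \<open>0\<close>,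
  which contributes \<open>n ^ 3\<close>, must be cancelled by the others. Frequencies at which \<open>f\<close> or \<open>f'\<close> is
  smaller than \<open>\<epsilon> * p\<close> contribute little. On the set \<open>R\<close> of the remaining ones, the contribution is at
  most \<open>M\<close> times half the sum of the energies of \<open>f\<close> and \<open>f'\<close> on \<open>R\<close>, and the Bessel inequality bounds
  this sum by \<open>n * (p - n)\<close> up to a small error, half of what Parseval's identity applied to \<open>f\<close> and
  \<open>f'\<close> separately would give. The inner products across the two families are Kloosterman sums.

  The truncation to \<open>R\<close> keeps the error term under control: by Parseval, the coefficients at frequencies
  in \<open>R\<close> have absolute sum at most \<open>n / \<epsilon>\<close>.
\<close>
lemma no_solution_bound:
  fixes A :: "int set" and x :: int and K M \<epsilon> :: real
  defines "n \<equiv> real (card A)"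
  assumes A: "A \<subseteq> Zp" "A \<noteq> {}" and x: "\<not> int p dvd x"
    and none: "\<And>a b c. a \<in> A \<Longrightarrow> b \<in> A \<Longrightarrow> c \<in> A \<Longrightarrow> \<not> int p dvd a + b - x * modinv c"
    and K: "\<And>u v. \<not> int p dvd u \<Longrightarrow> norm (kloosterman u v) \<le> K"
    and M: "\<And>r. \<not> int p dvd r \<Longrightarrow> norm (\<Sum>a\<in>A. e (r * a)) \<le> M"
    and \<epsilon>: "0 < \<epsilon>"
  shows "n\<^sup>2 \<le> M / 2 * (real p - n + 2 * K * n / (\<epsilon>\<^sup>2 * real p)) + 2 * \<epsilon> * (real p)\<^sup>2"
proof -
  define g where "g a = x * modinv a" for a
  define f where "f r = (\<Sum>a\<in>A. e (r * a))" for r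
  define f' where "f' r = (\<Sum>a\<in>A. e (r * g a))" for r
  define \<delta> where "\<delta> = \<epsilon> * real p"
  define R where "R = {r \<in> Zp - {0}. \<delta> \<le> norm (f r) \<and> \<delta> \<le> norm (f' r)}"
  have \<delta>: "0 < \<delta>" using \<epsilon> by (simp add: \<delta>_def)
  have fin: "finite A" using A finite_Zp finite_subset by blast
  have n: "0 < n" using A fin by (simp add: n_def card_gt_0_iff)
  have R: "R \<subseteq> Zp - {0}" by (auto simp: R_def)
  have g: "inj_mod g Zp"
  proof -
    have "int p dvd modinv a - modinv b" if "int p dvd x * modinv a - x * modinv b" for a b
    proof -
      have "int p dvd x * (modinv a - modinv b)" using that by (simp add: right_diff_distrib)
      thus ?thesis using x prime_int prime_dvd_mult_iff by blast
    qed
    thus ?thesis using modinv_inj unfolding inj_mod_def g_def by blast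
  qed
  have M0: "0 \<le> M" using M[of 1] gt2 norm_ge_zero order_trans by (metis not_prime_unit prime_int)
  have parsevals: "(\<Sum>r\<in>Zp. (norm (f r))\<^sup>2) = real p * n" "(\<Sum>r\<in>Zp. (norm (f' r))\<^sup>2) = real p * n"
  proof -
    have "inj_mod (\<lambda>a. a) A" using A Zp_dvd_diff_iff by (auto simp: inj_mod_def)
    from parseval[OF fin this, of "\<lambda>_. 1"] show "(\<Sum>r\<in>Zp. (norm (f r))\<^sup>2) = real p * n"
      by (simp add: f_def n_def)
    have "inj_mod g A" using A g by (auto simp: inj_mod_def)
    from parseval[OF fin this, of "\<lambda>_. 1"] show "(\<Sum>r\<in>Zp. (norm (f' r))\<^sup>2) = real p * n"
      by (simp add: f'_def n_def)
  qed
  have count: "(\<Sum>r\<in>Zp. (f r)\<^sup>2 * cnj (f' r)) = 0"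
  proof -
    have "(f r)\<^sup>2 = (\<Sum>i\<in>A \<times> A. 1 * e (r * (fst i + snd i)))" for r
      unfolding f_def power2_eq_square sum_product sum.cartesian_product
      by (simp add: case_prod_beta e_add distrib_left)
    moreover have "f' r = (\<Sum>c\<in>A. 1 * e (r * g c))" for r by (simp add: f'_def)
    ultimately have "(\<Sum>r\<in>Zp. (f r)\<^sup>2 * cnj (f' r)) = (\<Sum>i\<in>A \<times> A. \<Sum>c\<in>A. 1 * cnj 1 *
        (\<Sum>r\<in>Zp. e (r * (fst i + snd i)) * cnj (e (r * g c))))"
      by (simp only: sum_mult_cnj_expand)
    also have "\<dots> = (\<Sum>i\<in>A \<times> A. \<Sum>c\<in>A. \<Sum>r\<in>Zp. e (r * (fst i + snd i - g c)))"
      by (simp add: e_diff[symmetric] right_diff_distrib)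
    also have "\<dots> = 0" unfolding sum_e g_def using none by (intro sum.neutral ballI) auto
    finally show ?thesis .
  qed
  have cube: "n ^ 3 \<le> (\<Sum>r\<in>Zp - {0}. (norm (f r))\<^sup>2 * norm (f' r))"
  proof -
    have "f 0 = of_real n" "f' 0 = of_real n" by (simp_all add: f_def f'_def n_def)
    hence "of_real (n ^ 3) + (\<Sum>r\<in>Zp - {0}. (f r)\<^sup>2 * cnj (f' r)) = 0"
      using count sum.remove[of Zp 0 "\<lambda>r. (f r)\<^sup>2 * cnj (f' r)"]
      by (simp add: power3_eq_cube power2_eq_square)
    hence "complex_of_real (n ^ 3) = - (\<Sum>r\<in>Zp - {0}. (f r)\<^sup>2 * cnj (f' r))"
      by (rule eq_neg_iff_add_eq_0[THEN iffD2])
    hence "norm (complex_of_real (n ^ 3)) = norm (\<Sum>r\<in>Zp - {0}. (f r)\<^sup>2 * cnj (f' r))"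
      by (simp only: norm_minus_cancel)
    also have "\<dots> \<le> (\<Sum>r\<in>Zp - {0}. (norm (f r))\<^sup>2 * norm (f' r))"
      by (intro sum_norm_le) (simp add: norm_mult norm_power)
    finally show ?thesis using n by (simp del: of_real_power)
  qed
  define S where "S = (\<Sum>r\<in>R. (norm (f r))\<^sup>2 + (norm (f' r))\<^sup>2)"
  have "(\<Sum>r\<in>Zp - {0}. (norm (f r))\<^sup>2 * norm (f' r)) \<le>
    (\<Sum>r\<in>Zp - {0}. (if r \<in> R then M / 2 * ((norm (f r))\<^sup>2 + (norm (f' r))\<^sup>2) else 0)
        + \<delta> * (3 / 2 * (norm (f r))\<^sup>2 + 1 / 2 * (norm (f' r))\<^sup>2))"
  proof (intro sum_mono)
    fix r assume r: "r \<in> Zp - {0}"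
    define s t where "s = norm (f r)" and "t = norm (f' r)"
    have st: "0 \<le> s" "0 \<le> t" "s * t \<le> (s\<^sup>2 + t\<^sup>2) / 2"
      using sum_squares_bound[of s t] by (simp_all add: s_def t_def)
    have lin: "(x + y) / 2 \<le> 3 / 2 * x + 1 / 2 * y" "x \<le> 3 / 2 * x + 1 / 2 * y"
      if "0 \<le> x" "0 \<le> y" for x y :: real using that by (simp_all add: field_simps)
    have "s \<le> M" unfolding s_def f_def using r Zp_dvd_iff by (intro M) auto
    have "s\<^sup>2 * t \<le> (if r \<in> R then M / 2 * (s\<^sup>2 + t\<^sup>2) else 0) + \<delta> * (3 / 2 * s\<^sup>2 + 1 / 2 * t\<^sup>2)"
    proof (cases "r \<in> R")
      case True
      have "s\<^sup>2 * t = s * (s * t)" by (simp add: power2_eq_square)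
      also have "\<dots> \<le> M * ((s\<^sup>2 + t\<^sup>2) / 2)" using \<open>s \<le> M\<close> st M0 by (intro mult_mono) auto
      also have "\<dots> \<le> M * ((s\<^sup>2 + t\<^sup>2) / 2) + \<delta> * (3 / 2 * s\<^sup>2 + 1 / 2 * t\<^sup>2)" using \<delta> by simp
      finally show ?thesis using True by simp
    next
      case False
      hence "s \<le> \<delta> \<or> t \<le> \<delta>" using r by (auto simp: R_def s_def t_def)
      thus ?thesis
      proof
        assume "s \<le> \<delta>"
        have "s\<^sup>2 * t = s * (s * t)" by (simp add: power2_eq_square)
        also have "\<dots> \<le> \<delta> * ((s\<^sup>2 + t\<^sup>2) / 2)" using \<open>s \<le> \<delta>\<close> st \<delta> by (intro mult_mono) auto
        also have "\<dots> \<le> \<delta> * (3 / 2 * s\<^sup>2 + 1 / 2 * t\<^sup>2)"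
          using \<delta> by (intro mult_left_mono lin) auto
        finally show ?thesis using False by simp
      next
        assume "t \<le> \<delta>"
        have "s\<^sup>2 * t \<le> s\<^sup>2 * \<delta>" using \<open>t \<le> \<delta>\<close> by (intro mult_left_mono) auto
        also have "\<dots> = \<delta> * s\<^sup>2" by simp
        also have "\<dots> \<le> \<delta> * (3 / 2 * s\<^sup>2 + 1 / 2 * t\<^sup>2)"
          using \<delta> by (intro mult_left_mono lin) auto
        finally show ?thesis using False by simp
      qed
    qed
    thus "(norm (f r))\<^sup>2 * norm (f' r) \<le>
      (if r \<in> R then M / 2 * ((norm (f r))\<^sup>2 + (norm (f' r))\<^sup>2) else 0)
        + \<delta> * (3 / 2 * (norm (f r))\<^sup>2 + 1 / 2 * (norm (f' r))\<^sup>2)" by (simp only: s_def t_def)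
  qed
  also have "\<dots> = M / 2 * S + \<delta> * (3 / 2 * (\<Sum>r\<in>Zp - {0}. (norm (f r))\<^sup>2)
      + 1 / 2 * (\<Sum>r\<in>Zp - {0}. (norm (f' r))\<^sup>2))"
  proof -
    have "(\<Sum>r\<in>Zp - {0}. if r \<in> R then M / 2 * ((norm (f r))\<^sup>2 + (norm (f' r))\<^sup>2) else 0) = M / 2 * S"
      using R by (simp add: sum.If_cases Int_absorb1 S_def sum_distrib_left)
    thus ?thesis by (simp only: sum.distrib sum_distrib_left[symmetric])
  qed
  also have "\<dots> \<le> M / 2 * S + \<delta> * (3 / 2 * (real p * n) + 1 / 2 * (real p * n))"
  proof -
    have "(\<Sum>r\<in>Zp - {0}. (norm (f r))\<^sup>2) \<le> real p * n"
      unfolding parsevals(1)[symmetric] by (intro sum_mono2) auto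
    moreover have "(\<Sum>r\<in>Zp - {0}. (norm (f' r))\<^sup>2) \<le> real p * n"
      unfolding parsevals(2)[symmetric] by (intro sum_mono2) auto
    ultimately show ?thesis using \<delta> by (intro add_left_mono mult_left_mono add_mono) auto
  qed
  finally have upper: "n ^ 3 \<le> M / 2 * S + 2 * \<delta> * (real p * n)"
    using cube by (simp add: algebra_simps)
  have l1: "(\<Sum>r\<in>R. norm (F r)) \<le> n / \<epsilon>"
    if F: "(\<Sum>r\<in>Zp. (norm (F r))\<^sup>2) = real p * n" "\<And>r. r \<in> R \<Longrightarrow> \<delta> \<le> norm (F r)"
    for F :: "int \<Rightarrow> complex"
  proof -
    have "\<delta> * (\<Sum>r\<in>R. norm (F r)) \<le> (\<Sum>r\<in>R. (norm (F r))\<^sup>2)"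
      unfolding sum_distrib_left power2_eq_square using F(2)
      by (intro sum_mono mult_right_mono) auto
    also have "\<dots> \<le> real p * n" unfolding F(1)[symmetric] using R by (intro sum_mono2) auto
    finally show ?thesis using \<epsilon> by (simp add: \<delta>_def field_simps)
  qed
  have K0: "0 \<le> K" using K[of 1 0] norm_ge_zero order_trans by (metis not_prime_unit prime_int)
  have "S \<le> real p * n - n\<^sup>2
      + 2 * K / real p * ((\<Sum>r\<in>R. norm (f r)) * (\<Sum>r\<in>R. norm (f' r)))"
    unfolding S_def f_def f'_def n_def
  proof (rule bessel_two_families[OF A(1) g R])
    fix r s assume "r \<in> R" "s \<in> R"
    hence "\<not> int p dvd r" using R Zp_dvd_iff by auto
    moreover have "(\<Sum>a\<in>Zp. e (r * a - s * g a)) = kloosterman r (- (s * x))"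
      by (simp add: kloosterman_def g_def mult.assoc)
    ultimately show "norm (\<Sum>a\<in>Zp. e (r * a - s * g a)) \<le> K" using K by simp
  qed
  also have "\<dots> \<le> real p * n - n\<^sup>2 + 2 * K / real p * ((n / \<epsilon>) * (n / \<epsilon>))"
    using K0 n \<epsilon> l1[OF parsevals(1)] l1[OF parsevals(2)]
    by (intro add_left_mono mult_left_mono mult_mono) (auto simp: R_def intro!: sum_nonneg)
  also have "\<dots> = n * (real p - n + 2 * K * n / (\<epsilon>\<^sup>2 * real p))"
    using \<epsilon> by (simp add: field_simps power2_eq_square)
  finally have "M / 2 * S \<le> M / 2 * (n * (real p - n + 2 * K * n / (\<epsilon>\<^sup>2 * real p)))"
    using M0 by (intro mult_left_mono) auto
  with upper have "n * n\<^sup>2 \<le> n * (M / 2 * (real p - n + 2 * K * n / (\<epsilon>\<^sup>2 * real p)) + 2 * \<epsilon> * (real p)\<^sup>2)"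
    by (simp add: \<delta>_def power2_eq_square power3_eq_cube algebra_simps)
  thus ?thesis using n by (rule mult_left_le_imp_le)
qed

text \<open>
  Here \<open>M = 0.266 * p\<close>, \<open>K = p / 10 ^ 12\<close> and \<open>\<epsilon> = 1 / 10 ^ 4\<close>. For a set of density \<open>\<alpha>\<close> the bound of the
  previous lemma reads \<open>\<alpha>\<^sup>2 \<le> 0.133 * (1 - \<alpha>)\<close> up to errors below \<open>3 / 10 ^ 4\<close>, which fails for
  \<open>\<alpha> \<ge> 0.305\<close>: the left-hand side is at least \<open>0.0930\<close>, the right-hand side at most \<open>0.0925\<close>. The upper
  limit on the density keeps the Fourier coefficients below \<open>M\<close>. The bound on \<open>p\<close> is what makes the
  Kloosterman bound \<open>14 * p ^ 3\<close> at most \<open>K ^ 4\<close>.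
\<close>
lemma solution_exists:
  assumes A: "A \<subseteq> Zp" "0.305 * real p \<le> real (card A)" "real (card A) \<le> 0.3051 * real p"
    and x: "\<not> int p dvd x" and p: "p \<ge> 14 * 10 ^ 48"
  shows "\<exists>a\<in>A. \<exists>b\<in>A. \<exists>c\<in>A. int p dvd a + b - x * modinv c"
proof (rule ccontr)
  assume none: "\<not> ?thesis"
  define P n where "P = real p" and "n = real (card A)"
  have P: "14 * 10 ^ 48 \<le> P" "0 < P" using of_nat_mono[OF p, where 'a = real] by (simp_all add: P_def)
  have nb: "0.305 * P \<le> n" "n \<le> 0.3051 * P" using A by (simp_all add: P_def n_def)
  have ne: "A \<noteq> {}" using nb P by (auto simp: n_def)
  have K: "norm (kloosterman u v) \<le> 1 / 10 ^ 12 * P" if "\<not> int p dvd u" for u v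
  proof -
    have "norm (kloosterman u v) ^ 4 \<le> 14 * P ^ 3" using kloosterman_bound[OF that] by (simp add: P_def)
    also have "\<dots> \<le> P / 10 ^ 48 * P ^ 3" using P by (intro mult_right_mono) auto
    also have "\<dots> = (1 / 10 ^ 12 * P) ^ 4" by (simp add: power_mult_distrib power_divide eval_nat_numeral)
    finally have "norm (kloosterman u v) ^ 4 \<le> (1 / 10 ^ 12 * P) ^ 4" .
    moreover have "0 \<le> 1 / 10 ^ 12 * P" using P by simp
    ultimately show ?thesis by (metis norm_ge_zero power_mono_iff zero_less_numeral)
  qed
  have M: "norm (\<Sum>a\<in>A. e (r * a)) \<le> 0.266 * P" if "\<not> int p dvd r" for r
  proof -
    have "sqrt 3 \<le> 1.7321" by (rule real_le_lsqrt) (auto simp: power2_eq_square)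
    hence "sqrt 3 \<le> 0.2795 * (2 * pi)" using pi_gt_31_10 by simp
    hence "sqrt 3 / (2 * pi) \<le> 0.2795" by (simp add: pos_divide_le_eq)
    hence "P * (sqrt 3 / (2 * pi) - 1 / 6) \<le> P * (0.2795 - 1 / 6)"
      using P by (intro mult_left_mono) auto
    then obtain w where w: "w = P * (sqrt 3 / (2 * pi) - 1 / 6)" "w \<le> P * (0.2795 - 1 / 6)"
      by blast
    have "n / 2 + w + 6 \<le> 0.266 * P" using w(2) nb P by simp
    thus ?thesis using fourier_coefficient_le[OF A(1) that] by (simp add: P_def n_def w(1))
  qed
  have "n\<^sup>2 \<le> 0.266 * P / 2 * (P - n + 2 * (1 / 10 ^ 12 * P) * n / ((1 / 10 ^ 4)\<^sup>2 * P)) + 2 * (1 / 10 ^ 4) * P\<^sup>2"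
    unfolding n_def P_def
    by (rule no_solution_bound[OF A(1) ne x]) (use none K M in \<open>auto simp: P_def\<close>)
  also have "P - n + 2 * (1 / 10 ^ 12 * P) * n / ((1 / 10 ^ 4)\<^sup>2 * P) = P - n + n / 5000"
    using P by (simp add: field_simps)
  also have "\<dots> \<le> 0.6951 * P" using nb by simp
  hence "0.266 * P / 2 * (P - n + n / 5000) \<le> 0.266 * P / 2 * (0.6951 * P)"
    using P by (intro mult_left_mono) auto
  finally have "n\<^sup>2 \<le> (0.266 / 2 * 0.6951 + 2 / 10 ^ 4) * P\<^sup>2"
    by (simp add: power2_eq_square algebra_simps)
  moreover have "(0.305 * P)\<^sup>2 \<le> n\<^sup>2" using nb P by (intro power_mono) auto
  ultimately have "P\<^sup>2 \<le> 0" by (simp add: power_mult_distrib power2_eq_square)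
  thus False using P by simp
qed

end

theorem theorem1p1:
  shows "\<exists>p0::nat. \<forall>p::nat. prime p \<and> p \<ge> p0 \<longrightarrow>
    (\<forall>(A::int set) (\<alpha>::real).
      A \<subseteq> carrier (prime_field p) \<and> real (card A) = \<alpha> * real p \<and> \<alpha> \<ge> 0.3051 \<longrightarrow>
      carrier (prime_field p) - {\<zero>\<^bsub>prime_field p\<^esub>} \<subseteq> prod_of_sumset (prime_field p) A)"
proof (intro exI[of _ "14 * 10 ^ 48"] allI impI subsetI; elim conjE)
  fix p :: nat and A :: "int set" and \<alpha> :: real and x :: int
  assume p: "prime p" "14 * 10 ^ 48 \<le> p" and A: "A \<subseteq> carrier (prime_field p)"
    and \<alpha>: "real (card A) = \<alpha> * real p" "0.3051 \<le> \<alpha>"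
    and x: "x \<in> carrier (prime_field p) - {\<zero>\<^bsub>prime_field p\<^esub>}"
  interpret prime_modulus p using p by unfold_locales auto
  have F: "carrier (prime_field p) = Zp" "\<zero>\<^bsub>prime_field p\<^esub> = 0"
    "\<And>a b. a \<oplus>\<^bsub>prime_field p\<^esub> b = (a + b) mod int p"
    "\<And>a b. a \<otimes>\<^bsub>prime_field p\<^esub> b = (a * b) mod int p"
    by (auto simp: residue_ring_def Zp_def)
  have xZ: "x \<in> Zp" and x0: "\<not> int p dvd x" using x F Zp_dvd_iff by auto
  \<comment> \<open>Removing \<open>0\<close> and rounding cost at most two elements, which the margin between \<open>0.3051\<close> and \<open>0.305\<close> absorbs.\<close>
  define N where "N = nat \<lfloor>0.3051 * real p\<rfloor> - 1"
  have P: "14 * 10 ^ 48 \<le> real p" using of_nat_mono[OF p(2), where 'a = real] by simp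
  have N: "real N \<le> 0.3051 * real p - 1" "0.305 * real p \<le> real N"
  proof -
    define z where "z = \<lfloor>0.3051 * real p\<rfloor>"
    have z: "real_of_int z \<le> 0.3051 * real p" "0.3051 * real p < real_of_int z + 1"
      unfolding z_def by linarith+
    have "1 \<le> real_of_int z" using z(2) P by simp
    hence "real N = real_of_int z - 1" unfolding N_def z_def[symmetric] by linarith
    with z P show "real N \<le> 0.3051 * real p - 1" "0.305 * real p \<le> real N"
      by simp_all
  qed
  have "0.3051 * real p \<le> real (card A)" unfolding \<alpha>(1) using \<alpha>(2) by (intro mult_right_mono) auto
  moreover have "card A - 1 \<le> card (A - {0})" by (simp add: card_Diff_singleton_if)
  ultimately have "N \<le> card (A - {0})" using N(1) by linarith
  then obtain B where B: "B \<subseteq> A - {0}" "card B = N" using obtain_subset_with_card_n by metis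
  have "\<exists>a\<in>B. \<exists>b\<in>B. \<exists>c\<in>B. int p dvd a + b - x * modinv c"
    by (rule solution_exists) (use A F B N x0 p(2) in auto)
  then obtain a b c where abc: "a \<in> A" "b \<in> A" "c \<in> A" "c \<noteq> 0"
    and d: "int p dvd a + b - x * modinv c" using B by blast
  have "\<not> int p dvd c" using abc A F Zp_dvd_iff by auto
  hence "int p dvd x * (c * modinv c - 1) + c * (a + b - x * modinv c)"
    using d mult_modinv by simp
  also have "x * (c * modinv c - 1) + c * (a + b - x * modinv c) = c * (a + b) - x"
    by (simp add: algebra_simps)
  finally have "(c * (a + b)) mod int p = x" using xZ by (metis Zp_mod mod_eq_dvd_iff)
  hence "x = c \<otimes>\<^bsub>prime_field p\<^esub> (a \<oplus>\<^bsub>prime_field p\<^esub> b)"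
    by (simp add: F mod_mult_right_eq)
  thus "x \<in> prod_of_sumset (prime_field p) A" using abc unfolding prod_of_sumset_eq by blast
qed

end
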